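(* For every rational number $\frac{r}{s}$, the right and left $q$-deformations $\left[\frac{r}{s}\right]_q^\sharp$ and $\left[\frac{r}{s}\right]_q^\flat$ are linked via $$g_q\left(\left[\frac{r}{s}\right]_q^\sharp\right)=\left[\frac{r}{s}\right]_{q^{-1}}^\flat,$$ where $g_q(x)=\frac{1+(x-1)q}{1+(q-1)x}$.
   Context: Here $q$ is a formal parameter; all transformations are M\"obius transformations acting on the projective line over the field of rational functions in $q$ (including the point $\infty$). Put $T_q(x)=qx+1$, $S_q(x)=-\frac{1}{qx}$ and $U_q=T_q\circ S_q\circ T_q$; for $q=1$ write $T(x)=x+1$ and $U(x)=\frac{1}{1+1/x}$. Every rational $\frac rs$ has a unique continued fraction expression of even length $\frac rs=[a_1,a_2,\dots,a_{2n}]$ (with $a_1\in\mathbb{Z}$ and $a_i\in\mathbb{Z}_{\geq 1}$ for $i\ge 2$), meaning $\frac rs=T^{a_1}U^{a_2}T^{a_3}\cdots U^{a_{2n}}(\infty)$. The right and left $q$-rationals are defined by $$\left[\tfrac{r}{s}\right]_q^\sharp=T_q^{a_1}U_q^{a_2}T_q^{a_3}\cdots U_q^{a_{2n}}(\infty),\qquad \left[\tfrac{r}{s}\right]_q^\flat=T_q^{a_1}U_q^{a_2}T_q^{a_3}\cdots U_q^{a_{2n}}\left(\tfrac{1}{1-q}\right).$$ $\left[\frac{r}{s}\right]_{q^{-1}}^\flat$ denotes the result of substituting $q^{-1}$ for $q$ in $\left[\frac{r}{s}\right]_{q}^\flat$. *)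

theory Defs
  imports
    "HOL-Computational_Algebra.Computational_Algebra"
    "HOL-Computational_Algebra.Field_as_Ring"
begin

section \<open>The projective line and its Moebius transformations\<close>

datatype 'a proj = Fin 'a | Infty

text \<open>The map \<open>x \<mapsto> (a x + b) / (c x + d)\<close>; it is only meaningful if \<open>a d - b c \<noteq> 0\<close>.\<close>

fun moebius :: "'a::field \<Rightarrow> 'a \<Rightarrow> 'a \<Rightarrow> 'a \<Rightarrow> 'a proj \<Rightarrow> 'a proj" where
  "moebius a b c d (Fin x) = (if c * x + d = 0 then Infty else Fin ((a * x + b) / (c * x + d)))"
| "moebius a b c d Infty = (if c = 0 then Infty else Fin (a / c))"

definition T_map :: "'a::field \<Rightarrow> 'a proj \<Rightarrow> 'a proj" where
  "T_map q = moebius q 1 0 1"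

definition S_map :: "'a::field \<Rightarrow> 'a proj \<Rightarrow> 'a proj" where
  "S_map q = moebius 0 (- 1) q 0"

definition U_map :: "'a::field \<Rightarrow> 'a proj \<Rightarrow> 'a proj" where
  "U_map q = T_map q \<circ> S_map q \<circ> T_map q"

text \<open>\<open>g_map q\<close> is \<open>x \<mapsto> (1 + (x - 1) q) / (1 + (q - 1) x)\<close> with the numerator expanded.\<close>

definition g_map :: "'a::field \<Rightarrow> 'a proj \<Rightarrow> 'a proj" where
  "g_map q = moebius q (1 - q) (q - 1) 1"

lemma T_one: "T_map 1 = moebius 1 1 0 1"
  by (simp add: T_map_def)

text \<open>\<open>x / (x + 1)\<close> is \<open>1 / (1 + 1 / x)\<close>, read on the projective line.\<close>

lemma U_one: "U_map 1 = moebius 1 0 1 1"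
proof
  fix x :: "'a proj"
  show "U_map 1 x = moebius 1 0 1 1 x"
    by (cases x) (auto simp: U_map_def T_map_def S_map_def field_simps)
qed

lemma bij_T:
  assumes "q \<noteq> 0"
  shows "bij (T_map q)"
proof (rule o_bij)
  show "moebius 1 (- 1) 0 q \<circ> T_map q = id"
  proof
    fix x show "(moebius 1 (- 1) 0 q \<circ> T_map q) x = id x"
      using assms by (cases x) (auto simp: T_map_def)
  qed
  show "T_map q \<circ> moebius 1 (- 1) 0 q = id"
  proof
    fix x show "(T_map q \<circ> moebius 1 (- 1) 0 q) x = id x"
      using assms by (cases x) (auto simp: T_map_def)
  qed
qed

section \<open>Continued fractions of even length\<close>

text \<open>Integer powers of a bijection.\<close>

definition zpow :: "('a \<Rightarrow> 'a) \<Rightarrow> int \<Rightarrow> 'a \<Rightarrow> 'a" where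
  "zpow f k = (if 0 \<le> k then f ^^ nat k else inv f ^^ nat (- k))"

text \<open>\<open>alt_word f h [a\<^sub>1, a\<^sub>2, a\<^sub>3, \<dots>] = f\<^sup>a\<^sup>1 h\<^sup>a\<^sup>2 f\<^sup>a\<^sup>3 \<cdots>\<close>\<close>

fun alt_word :: "('a \<Rightarrow> 'a) \<Rightarrow> ('a \<Rightarrow> 'a) \<Rightarrow> int list \<Rightarrow> 'a \<Rightarrow> 'a" where
  "alt_word f h [] = id"
| "alt_word f h (a # as) = zpow f a \<circ> alt_word h f as"

definition cf_word :: "'a::field \<Rightarrow> int list \<Rightarrow> 'a proj \<Rightarrow> 'a proj" where
  "cf_word q = alt_word (T_map q) (U_map q)"

text \<open>The empty list is excluded automatically, as its value is \<open>Infty\<close>.\<close>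

definition is_even_cf :: "rat \<Rightarrow> int list \<Rightarrow> bool" where
  "is_even_cf x as \<longleftrightarrow>
     even (length as) \<and> (\<forall>a \<in> set (tl as). 1 \<le> a) \<and> cf_word 1 as Infty = Fin x"

definition even_cf :: "rat \<Rightarrow> int list" where
  "even_cf x = (THE as. is_even_cf x as)"

section \<open>Rational functions in \<open>q\<close>\<close>

type_synonym ratfun = "rat poly fract"

definition qvar :: ratfun where
  "qvar = to_fract [:0, 1:]"

definition ratfun_const :: "rat \<Rightarrow> ratfun" where
  "ratfun_const c = to_fract [:c:]"

text \<open>The result of substituting \<open>h\<close> for \<open>q\<close> in \<open>f\<close>. It is meaningful if \<open>h\<close> is not a root of
  the denominator of \<open>f\<close>, in particular if \<open>h\<close> is not a constant.\<close>

definition ratfun_subst :: "ratfun \<Rightarrow> ratfun \<Rightarrow> ratfun" where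
  "ratfun_subst h f =
     (case quot_of_fract f of (a, b) \<Rightarrow>
        poly (map_poly ratfun_const a) h / poly (map_poly ratfun_const b) h)"

definition right_qrat :: "rat \<Rightarrow> ratfun proj" where
  "right_qrat x = cf_word qvar (even_cf x) Infty"

definition left_qrat :: "rat \<Rightarrow> ratfun proj" where
  "left_qrat x = cf_word qvar (even_cf x) (Fin (1 / (1 - qvar)))"

section \<open>The definitions above are meaningful\<close>

subsection \<open>Substituting \<open>1 / q\<close>\<close>

lemma ratfun_const_0 [simp]: "ratfun_const 0 = 0"
  and ratfun_const_1 [simp]: "ratfun_const 1 = 1"
  and ratfun_const_add: "ratfun_const (a + b) = ratfun_const a + ratfun_const b"
  and ratfun_const_mult: "ratfun_const (a * b) = ratfun_const a * ratfun_const b"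
  and ratfun_const_eq_0 [simp]: "ratfun_const a = 0 \<longleftrightarrow> a = 0"
  by (simp_all add: ratfun_const_def flip: to_fract_add to_fract_mult one_pCons)

lemma qvar_neq_0 [simp]: "qvar \<noteq> 0"
  by (simp add: qvar_def)

lemma poly_ratfun_const_qvar: "poly (map_poly ratfun_const p) qvar = to_fract p"
proof (induction p)
  case 0
  then show ?case by simp
next
  case (pCons a p)
  have "to_fract (pCons a p) = to_fract ([:a:] + [:0, 1:] * p)"
    by simp
  also have "\<dots> = ratfun_const a + qvar * to_fract p"
    unfolding to_fract_add to_fract_mult ratfun_const_def qvar_def ..
  finally show ?case
    using pCons by (simp add: map_poly_pCons)
qed

lemma map_poly_ratfun_const_mult:
  "map_poly ratfun_const (a * b) = map_poly ratfun_const a * map_poly ratfun_const b"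
proof -
  have sum: "ratfun_const (\<Sum>i\<in>A. f i) = (\<Sum>i\<in>A. ratfun_const (f i))" for A :: "nat set" and f
    by (induction A rule: infinite_finite_induct) (simp_all add: ratfun_const_add)
  show ?thesis
    by (rule poly_eqI) (simp add: coeff_map_poly coeff_mult sum ratfun_const_mult)
qed

lemma poly_ratfun_const_inverse_qvar:
  assumes "b \<noteq> 0"
  shows "poly (map_poly ratfun_const b) (inverse qvar) \<noteq> 0"
proof
  assume *: "poly (map_poly ratfun_const b) (inverse qvar) = 0"
  have "degree (map_poly ratfun_const b) = degree b"
    by (simp add: degree_map_poly)
  hence "reflect_poly (map_poly ratfun_const b) = map_poly ratfun_const (reflect_poly b)"
    by (intro poly_eqI) (simp add: coeff_reflect_poly coeff_map_poly)
  moreover have "poly (reflect_poly (map_poly ratfun_const b)) qvar = 0"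
    using * by (simp add: poly_reflect_poly_nz)
  ultimately show False
    using assms by (simp add: poly_ratfun_const_qvar)
qed

lemma ratfun_subst_inverse_Fract:
  assumes "b \<noteq> 0"
  shows "ratfun_subst (inverse qvar) (Fract a b) =
    poly (map_poly ratfun_const a) (inverse qvar) / poly (map_poly ratfun_const b) (inverse qvar)"
proof -
  obtain a' b' where q: "quot_of_fract (Fract a b) = (a', b')"
    by fastforce
  have b': "b' \<noteq> 0"
    using snd_quot_of_fract_nonzero[of "Fract a b"] q by simp
  have "Fract a b = Fract a' b'"
    using quot_to_fract_quot_of_fract[of "Fract a b"] q by (simp add: quot_to_fract_def)
  hence "a * b' = a' * b"
    using assms b' by (simp add: eq_fract)
  hence "poly (map_poly ratfun_const (a * b')) (inverse qvar) =
         poly (map_poly ratfun_const (a' * b)) (inverse qvar)"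
    by simp
  thus ?thesis
    using poly_ratfun_const_inverse_qvar[OF assms] poly_ratfun_const_inverse_qvar[OF b'] q
    by (simp add: ratfun_subst_def map_poly_ratfun_const_mult field_simps)
qed

subsection \<open>Existence and uniqueness of the even continued fraction\<close>

lemma T_one_Fin [simp]: "T_map 1 (Fin x) = Fin (x + 1)" and T_one_Infty [simp]: "T_map 1 Infty = Infty"
  by (simp_all add: T_one)

lemma zpow_T_one: "zpow (T_map 1) k (Fin x) = Fin (x + of_int k :: rat)"
proof -
  have inv: "inv (T_map 1) (Fin y) = Fin (y - 1)" for y :: rat
    by (rule inv_f_eq[OF bij_is_inj[OF bij_T]]) simp_all
  have "(T_map 1 ^^ n) (Fin x) = Fin (x + of_nat n)" for n
    by (induction n) simp_all
  moreover have "(inv (T_map 1) ^^ n) (Fin x) = Fin (x - of_nat n)" for n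
    by (induction n) (simp_all add: inv)
  ultimately show ?thesis
    by (simp add: zpow_def)
qed

lemma funpow_U_one_Infty: "n > 0 \<Longrightarrow> (U_map 1 ^^ n) Infty = Fin (1 / of_nat n :: rat)"
proof (induction n)
  case (Suc n)
  show ?case
  proof (cases "n = 0")
    case False
    have "1 + of_nat n \<noteq> (0 :: rat)"
      by (metis add.commute of_nat_Suc of_nat_neq_0)
    with False Suc show ?thesis
      by (auto simp: U_one field_simps)
  qed (simp add: U_one)
qed simp

lemma funpow_U_one_Fin:
  assumes "y > 0"
  shows "(U_map 1 ^^ n) (Fin y) = Fin (1 / (of_nat n + 1 / y) :: rat)"
proof (induction n)
  case (Suc n)
  have p: "of_nat n + 1 / y > 0"
    using assms by (intro add_nonneg_pos) auto
  define z where "z = of_nat n + 1 / y"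
  have "(U_map 1 ^^ Suc n) (Fin y) = U_map 1 (Fin (1 / z))"
    by (simp add: Suc z_def)
  also have "\<dots> = Fin (1 / (z + 1))"
    using p[folded z_def] by (auto simp: U_one field_simps)
  finally show ?case
    by (simp add: z_def add_ac)
qed simp

lemma zpow_U_one:
  assumes "1 \<le> b"
  shows "zpow (U_map 1) b Infty = Fin (1 / of_int b :: rat)"
    and "y > 0 \<Longrightarrow> zpow (U_map 1) b (Fin y) = Fin (1 / (of_int b + 1 / y) :: rat)"
  using assms by (simp_all add: zpow_def funpow_U_one_Infty funpow_U_one_Fin)

lemma is_even_cf_Nil [simp]: "\<not> is_even_cf x []"
  by (simp add: is_even_cf_def cf_word_def)

lemma is_even_cf_single [simp]: "\<not> is_even_cf x [a]"
  by (simp add: is_even_cf_def)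

lemma is_even_cf_pair: "is_even_cf x [a, b] \<longleftrightarrow> 1 \<le> b \<and> x = of_int a + 1 / of_int b"
  by (auto simp: is_even_cf_def cf_word_def zpow_U_one zpow_T_one)

lemma even_cf_value:
  assumes "even (length as)" "as \<noteq> []" "\<forall>a\<in>set (tl as). 1 \<le> a"
  shows "\<exists>y. is_even_cf y as \<and> of_int (hd as) < y \<and> y \<le> of_int (hd as) + 1"
  using assms
proof (induction as rule: induct_list012)
  case (3 a b as)
  have b: "1 \<le> b" using 3 by simp
  show ?case
  proof (cases "as = []")
    case True
    thus ?thesis using b by (auto simp: is_even_cf_pair)
  next
    case False
    then obtain y where y: "is_even_cf y as" "of_int (hd as) < y"
      using "3.IH"(1) "3.prems" by (cases as) auto
    have "1 \<le> hd as" using False 3 by (cases as) auto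
    hence y1: "y > 1" using y(2) by linarith
    moreover have "of_int b \<ge> (1 :: rat)" using b by simp
    moreover have "1 / y > 0" using y1 by simp
    ultimately have "of_int b + 1 / y > 1" by linarith
    hence "0 < 1 / (of_int b + 1 / y)" "1 / (of_int b + 1 / y) \<le> 1"
      by simp_all
    moreover have "is_even_cf (of_int a + 1 / (of_int b + 1 / y)) (a # b # as)"
      using y y1 b "3.prems" by (simp add: is_even_cf_def cf_word_def zpow_U_one zpow_T_one)
    ultimately show ?thesis
      by (intro exI[of _ "of_int a + 1 / (of_int b + 1 / y)"]) simp
  qed
qed auto

lemma is_even_cf_hd:
  assumes "is_even_cf x as"
  shows "of_int (hd as) < x" "x \<le> of_int (hd as) + 1"
proof -
  from assms have "as \<noteq> []" by auto
  with assms even_cf_value[of as] obtain y where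
    y: "is_even_cf y as" "of_int (hd as) < y" "y \<le> of_int (hd as) + 1"
    by (auto simp: is_even_cf_def)
  have "y = x" using y(1) assms by (simp add: is_even_cf_def)
  with y show "of_int (hd as) < x" "x \<le> of_int (hd as) + 1" by auto
qed

lemma is_even_cf_Cons_Cons:
  "is_even_cf x (a # b # as) \<longleftrightarrow> 1 \<le> b \<and>
     (as = [] \<and> x = of_int a + 1 / of_int b \<or>
      (\<exists>y>1. is_even_cf y as \<and> x = of_int a + 1 / (of_int b + 1 / y)))"
proof (cases "as = []")
  case False
  show ?thesis
  proof
    assume *: "is_even_cf x (a # b # as)"
    hence b: "1 \<le> b" and h: "1 \<le> hd as" and tl: "\<forall>a\<in>set (tl as). 1 \<le> a" "even (length as)"
      using False by (cases as; auto simp: is_even_cf_def)+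
    then obtain y where y: "is_even_cf y as" "of_int (hd as) < y"
      using even_cf_value False by blast
    have "y > 1" using h y(2) by linarith
    moreover from this have "x = of_int a + 1 / (of_int b + 1 / y)"
      using y(1) * b by (simp add: is_even_cf_def cf_word_def zpow_U_one zpow_T_one)
    ultimately show "1 \<le> b \<and> (as = [] \<and> x = of_int a + 1 / of_int b \<or>
      (\<exists>y>1. is_even_cf y as \<and> x = of_int a + 1 / (of_int b + 1 / y)))"
      using y(1) b by blast
  next
    assume "1 \<le> b \<and> (as = [] \<and> x = of_int a + 1 / of_int b \<or>
      (\<exists>y>1. is_even_cf y as \<and> x = of_int a + 1 / (of_int b + 1 / y)))"
    with False obtain y where b: "1 \<le> b" and y: "y > 1" "is_even_cf y as"
      and x: "x = of_int a + 1 / (of_int b + 1 / y)" by blast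
    have "of_int (hd as + 1) > (1 :: rat)"
      using is_even_cf_hd(2)[OF y(2)] y(1) by simp
    hence "1 \<le> hd as" by linarith
    hence "\<forall>c\<in>set as. 1 \<le> c"
      using y(2) False by (cases as) (auto simp: is_even_cf_def)
    thus "is_even_cf x (a # b # as)"
      using b y x by (simp add: is_even_cf_def cf_word_def zpow_U_one zpow_T_one)
  qed
qed (auto simp: is_even_cf_pair)

lemma is_even_cf_unique: "is_even_cf x as \<Longrightarrow> is_even_cf x bs \<Longrightarrow> as = bs"
proof (induction as arbitrary: x bs rule: induct_list012)
  case (3 a b as)
  obtain a' b' bs' where bs: "bs = a' # b' # bs'"
    using "3.prems"(2) by (metis is_even_cf_Nil is_even_cf_single neq_Nil_conv)
  have "of_int a < of_int a' + (1 :: rat)" "of_int a' < of_int a + (1 :: rat)"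
    using is_even_cf_hd[OF "3.prems"(1)] is_even_cf_hd[OF "3.prems"(2)] bs by auto
  hence a: "a' = a" by linarith
  define z where "z = inverse (x - of_int a)"
  have frac: "floor (of_int c + 1 / y) = c" "of_int c + 1 / y \<noteq> of_int d"
    if "y > 1" for c d :: int and y :: rat
  proof -
    have "0 < 1 / y" "1 / y < 1" using that by auto
    thus "floor (of_int c + 1 / y) = c" by linarith
    show "of_int c + 1 / y \<noteq> of_int d"
    proof
      assume "of_int c + 1 / y = of_int d"
      hence "1 / y = of_int (d - c)" by simp
      with \<open>0 < 1 / y\<close> \<open>1 / y < 1\<close> have "0 < d - c" "d - c < 1"
        by (metis of_int_0_less_iff, metis of_int_less_1_iff)
      thus False by simp
    qed
  qed
  have 1: "as = [] \<and> z = of_int b \<or> (\<exists>y>1. is_even_cf y as \<and> z = of_int b + 1 / y)"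
    using "3.prems"(1) by (auto simp: is_even_cf_Cons_Cons z_def)
  have 2: "bs' = [] \<and> z = of_int b' \<or> (\<exists>y>1. is_even_cf y bs' \<and> z = of_int b' + 1 / y)"
    using "3.prems"(2) by (auto simp: is_even_cf_Cons_Cons z_def a bs)
  show ?case
  proof (cases "as = []")
    case True
    with 1 have z: "z = of_int b" by auto
    with 2 frac(2) have "bs' = []" "z = of_int b'" by metis+
    with True z show ?thesis by (simp add: a bs)
  next
    case False
    with 1 obtain y where y: "y > 1" "is_even_cf y as" "z = of_int b + 1 / y" by blast
    with 2 frac(2) obtain y' where y': "y' > 1" "is_even_cf y' bs'" "z = of_int b' + 1 / y'"
      by metis
    have b: "b' = b" using frac(1) y(1,3) y'(1,3) by metis
    hence "y' = y" using y(3) y'(3) by simp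
    with y'(2) have "as = bs'" using "3.IH"(1) y(2) by blast
    thus ?thesis by (simp add: a b bs)
  qed
qed auto

lemma is_even_cf_exists_aux:
  "s > 0 \<Longrightarrow> \<exists>as. is_even_cf (of_int r / of_nat s) as"
proof (induction s arbitrary: r rule: less_induct)
  case (less s)
  define x :: rat where "x = of_int r / of_nat s"
  define a where "a = ceiling x - 1"
  define p where "p = r - a * int s"
  have s: "of_nat s > (0 :: rat)" using less.prems by simp
  have ax: "of_int a < x" "x \<le> of_int a + 1" unfolding a_def by linarith+
  have xa: "x - of_int a = of_int p / of_nat s"
    using s by (simp add: x_def p_def field_simps)
  have "0 < of_int p / (of_nat s :: rat)" "of_int p / (of_nat s :: rat) \<le> 1"
    using ax xa by auto
  hence "0 < (of_int p :: rat)" "of_int p \<le> (of_int (int s) :: rat)"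
    using s by (auto simp: zero_less_divide_iff)
  hence p: "0 < p" "p \<le> int s" by (simp, linarith)
  define b where "b = int s div p"
  define t where "t = int s mod p"
  have sbt: "int s = b * p + t" by (simp add: b_def t_def)
  have t: "0 \<le> t" "t < p" using p by (auto simp: t_def)
  have b: "1 \<le> b" using p by (simp add: b_def pos_imp_zdiv_pos_iff int_one_le_iff_zero_less)
  have pr: "(of_int p :: rat) > 0" using p by simp
  have "(of_nat s :: rat) = of_int (b * p + t)" by (simp flip: sbt)
  hence quot: "of_nat s / of_int p = of_int b + (of_int t / of_int p :: rat)"
    using pr by (simp only: of_int_add of_int_mult add_divide_distrib) simp
  have x: "x = of_int a + 1 / (of_int b + of_int t / of_int p)"
  proof -
    have "1 / (of_int b + of_int t / of_int p) = of_int p / (of_nat s :: rat)"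
      by (subst quot [symmetric]) simp
    thus ?thesis using xa by linarith
  qed
  show ?case
  proof (cases "t = 0")
    case True
    hence "is_even_cf x [a, b]" using b x by (simp add: is_even_cf_pair)
    thus ?thesis by (auto simp: x_def)
  next
    case False
    hence t0: "t > 0" using t by simp
    have "nat t < s" "nat t > 0" using t0 t p by auto
    from less.IH[OF this, of p] obtain as where
      as: "is_even_cf (of_int p / of_int t) as" using t0 by auto
    have "of_int p / of_int t > (1 :: rat)" using t t0 by simp
    hence "is_even_cf x (a # b # as)"
      unfolding is_even_cf_Cons_Cons using b as x
      by (intro conjI disjI2 exI[of _ "of_int p / of_int t"]) auto
    thus ?thesis by (auto simp: x_def)
  qed
qed

theorem ex1_even_cf: "\<exists>!as. is_even_cf x as"
proof -
  obtain r s where q: "quotient_of x = (r, s)" by fastforce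
  have "s > 0" using quotient_of_denom_pos[OF q] .
  moreover have "x = of_int r / of_int s" using quotient_of_div[OF q] .
  ultimately have "\<exists>as. is_even_cf x as"
    using is_even_cf_exists_aux[of "nat s" r] by simp
  thus ?thesis using is_even_cf_unique by blast
qed

corollary is_even_cf_even_cf: "is_even_cf x (even_cf x)"
  unfolding even_cf_def by (rule theI') (rule ex1_even_cf)

end

theory Submission
  imports Defs
begin

text \<open>
  The map \<open>g\<^sub>q\<close> conjugates \<open>T\<^sub>q\<close> and \<open>S\<^sub>q\<close>, hence also \<open>U\<^sub>q\<close>, to \<open>T\<^bsub>1/q\<^esub>\<close> and \<open>S\<^bsub>1/q\<^esub>\<close>, and it
  sends \<open>\<infinity>\<close> to \<open>1 / (1 - 1/q)\<close>. The substitution of \<open>1/q\<close> for \<open>q\<close> is a field homomorphism, so it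
  maps \<open>T\<^sub>q\<close> and \<open>S\<^sub>q\<close> to the same two maps and \<open>1 / (1 - q)\<close> to the same point. Applying the word of
  the continued fraction therefore gives the same result on both sides.
\<close>

text \<open>Composition is the matrix product. As the inner determinant is nonzero, numerator and
  denominator of the inner map never vanish together; at a pole the factor
  \<open>a' * y + b'\<close> is therefore nonzero and cancels, leaving \<open>a / c\<close>.\<close>

lemma moebius_moebius:
  assumes "a' * d' - b' * c' \<noteq> 0"
  shows "moebius a b c d (moebius a' b' c' d' x) =
    moebius (a * a' + b * c') (a * b' + b * d') (c * a' + d * c') (c * b' + d * d') x"
proof (cases x)
  case (Fin y)
  show ?thesis
  proof (cases "c' * y + d' = 0")
    case True
    hence d': "d' = - (c' * y)"
      by (simp add: eq_neg_iff_add_eq_0 add.commute)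
    have "a' * d' - b' * c' = - c' * (a' * y + b')"
      unfolding d' by algebra
    hence "a' * y + b' \<noteq> 0"
      using assms by auto
    moreover have "(c * a' + d * c') * y + (c * b' + d * d') = c * (a' * y + b')"
      "(a * a' + b * c') * y + (a * b' + b * d') = a * (a' * y + b')"
      unfolding d' by algebra+
    ultimately show ?thesis
      using True Fin by simp
  next
    case False
    define u where "u = a' * y + b'"
    define v where "v = c' * y + d'"
    have *: "(c * a' + d * c') * y + (c * b' + d * d') = c * u + d * v"
      "(a * a' + b * c') * y + (a * b' + b * d') = a * u + b * v"
      unfolding u_def v_def by algebra+
    have v: "v \<noteq> 0"
      using False by (simp add: v_def)
    have "c * (u / v) + d = (c * u + d * v) / v" "a * (u / v) + b = (a * u + b * v) / v"
      using v by (simp_all add: field_simps)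
    thus ?thesis
      unfolding Fin moebius.simps * using v by (simp flip: u_def v_def)
  qed
next
  case Infty
  have "a' \<noteq> 0" if "c' = 0"
    using assms that by auto
  moreover have "c * (a' / c') + d = (c * a' + d * c') / c'"
      "a * (a' / c') + b = (a * a' + b * c') / c'" if "c' \<noteq> 0"
    using that by (simp_all add: field_simps)
  ultimately show ?thesis
    using Infty by auto
qed

text \<open>Proportional matrices act alike; this absorbs the scalar in the conjugation identities
  for \<open>g_map\<close>.\<close>

lemma moebius_scale:
  assumes "k \<noteq> 0" "a = k * a'" "b = k * b'" "c = k * c'" "d = k * d'"
  shows "moebius a b c d x = moebius a' b' c' d' x"
proof (cases x)
  case (Fin y)
  have "c * y + d = k * (c' * y + d')" "a * y + b = k * (a' * y + b')"
    using assms by (simp_all add: algebra_simps)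
  thus ?thesis
    using assms(1) Fin by simp
qed (use assms in simp)

lemma bij_S:
  assumes "q \<noteq> 0"
  shows "bij (S_map q)"
proof (rule involuntory_imp_bij)
  show "S_map q (S_map q x) = x" for x
    using assms by (cases x) (auto simp: S_map_def)
qed

lemma bij_U: "q \<noteq> 0 \<Longrightarrow> bij (U_map q)"
  unfolding U_map_def by (intro bij_comp bij_T bij_S)

text \<open>Intertwining two bijections passes to their inverses, hence to all integer powers; the
  first exponent of a continued fraction may be negative.\<close>

lemma alt_word_intertwine:
  assumes f: "bij f" "bij f'" "\<And>x. g (f x) = f' (g x)"
    and h: "bij h" "bij h'" "\<And>x. g (h x) = h' (g x)"
  shows "g (alt_word f h as x) = alt_word f' h' as (g x)"
proof -
  have zpow: "g (zpow e k x) = zpow e' k (g x)"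
    if "bij e" "bij e'" and comm: "\<And>x. g (e x) = e' (g x)" for e e' k x
  proof -
    have "(\<And>x. g (u x) = v (g x)) \<Longrightarrow> g ((u ^^ n) x) = (v ^^ n) (g x)" for u v n x
      by (induction n) simp_all
    moreover have "g (inv e x) = inv e' (g x)" for x
      using that by (metis bij_inv_eq_iff)
    ultimately show ?thesis
      using comm by (simp add: zpow_def)
  qed
  show ?thesis
    using f h
  proof (induction as arbitrary: f f' h h' x)
    case (Cons a as)
    show ?case
      \<comment> \<open>The two letters alternate, so the induction hypothesis is taken with
        \<open>f\<close> and \<open>h\<close> exchanged.\<close>
      using Cons.IH[OF Cons.prems(4-6,1-3)] zpow[OF Cons.prems(1-3)] by simp
  qed simp
qed

lemma cf_word_intertwine:
  assumes "q \<noteq> 0" "q' \<noteq> 0"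
    and T: "\<And>x. g (T_map q x) = T_map q' (g x)"
    and S: "\<And>x. g (S_map q x) = S_map q' (g x)"
  shows "g (cf_word q as x) = cf_word q' as (g x)"
  unfolding cf_word_def
  using assms by (intro alt_word_intertwine bij_T bij_U) (simp_all add: U_map_def)

text \<open>The matrix product on the left is \<open>q\<close> times the one on the right;
  \<open>q * q - q + 1\<close> is the determinant of \<open>g_map q\<close>.\<close>

lemma g_map_T_map:
  assumes "q \<noteq> 0" "q * q - q + 1 \<noteq> 0"
  shows "g_map q (T_map q x) = T_map (inverse q) (g_map q x)"
proof -
  have "q * 1 - (1 - q) * (q - 1) = q * q - q + 1"
    by algebra
  with assms show ?thesis
    unfolding g_map_def T_map_def
    by (intro trans[OF moebius_moebius trans[OF moebius_scale[of q] moebius_moebius[symmetric]]])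
       (simp_all add: field_simps)
qed

lemma g_map_S_map:
  assumes "q \<noteq> 0" "q * q - q + 1 \<noteq> 0"
  shows "g_map q (S_map q x) = S_map (inverse q) (g_map q x)"
proof -
  have "q * 1 - (1 - q) * (q - 1) = q * q - q + 1"
    by algebra
  with assms show ?thesis
    unfolding g_map_def S_map_def
    by (intro trans[OF moebius_moebius trans[OF moebius_scale[of q] moebius_moebius[symmetric]]])
       (simp_all add: field_simps)
qed

lemma map_poly_ratfun_const_add:
  "map_poly ratfun_const (a + b) = map_poly ratfun_const a + map_poly ratfun_const b"
  by (rule poly_eqI) (simp add: coeff_map_poly ratfun_const_add)

text \<open>No nonzero polynomial vanishes at \<open>inverse qvar\<close>, so the substitution can
  be computed from any representing fraction, reduced or not.\<close>

lemma ratfun_subst_inverse_add: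
  "ratfun_subst (inverse qvar) (x + y) =
     ratfun_subst (inverse qvar) x + ratfun_subst (inverse qvar) y"
proof (cases x, cases y)
  fix a b c d :: "rat poly"
  assume "x = Fract a b" "b \<noteq> 0" "y = Fract c d" "d \<noteq> 0"
  thus ?thesis
    by (simp add: ratfun_subst_inverse_Fract poly_ratfun_const_inverse_qvar
        map_poly_ratfun_const_add map_poly_ratfun_const_mult add_frac_eq)
qed

lemma ratfun_subst_inverse_mult:
  "ratfun_subst (inverse qvar) (x * y) =
     ratfun_subst (inverse qvar) x * ratfun_subst (inverse qvar) y"
proof (cases x, cases y)
  fix a b c d :: "rat poly"
  assume "x = Fract a b" "b \<noteq> 0" "y = Fract c d" "d \<noteq> 0"
  thus ?thesis
    by (simp add: ratfun_subst_inverse_Fract map_poly_ratfun_const_mult)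
qed

lemma ratfun_subst_inverse_0 [simp]: "ratfun_subst (inverse qvar) 0 = 0"
  and ratfun_subst_inverse_1 [simp]: "ratfun_subst (inverse qvar) 1 = 1"
  and ratfun_subst_inverse_qvar [simp]: "ratfun_subst (inverse qvar) qvar = inverse qvar"
proof -
  have "ratfun_subst (inverse qvar) (to_fract p) = poly (map_poly ratfun_const p) (inverse qvar)" for p
    by (simp add: to_fract_def ratfun_subst_inverse_Fract)
  from this[of 0] this[of 1] this[of "[:0, 1:]"]
  show "ratfun_subst (inverse qvar) 0 = 0" "ratfun_subst (inverse qvar) 1 = 1"
    "ratfun_subst (inverse qvar) qvar = inverse qvar"
    by (simp_all add: map_poly_pCons flip: qvar_def)
qed

text \<open>A field homomorphism is injective, so a denominator vanishes exactly when its image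
  does, and poles go to poles.\<close>

lemma map_proj_moebius:
  fixes \<sigma> :: "'a::field \<Rightarrow> 'b::field"
  assumes add: "\<And>x y. \<sigma> (x + y) = \<sigma> x + \<sigma> y" and mult: "\<And>x y. \<sigma> (x * y) = \<sigma> x * \<sigma> y"
    and one: "\<sigma> 1 = 1"
  shows "map_proj \<sigma> (moebius a b c d x) = moebius (\<sigma> a) (\<sigma> b) (\<sigma> c) (\<sigma> d) (map_proj \<sigma> x)"
proof -
  have zero: "\<sigma> 0 = 0"
    using add[of 0 0] by (metis add_0_right add_left_cancel)
  have inv: "\<sigma> y * \<sigma> (inverse y) = 1" if "y \<noteq> 0" for y
    using that one by (simp flip: mult)
  have eq_0: "\<sigma> y = 0 \<longleftrightarrow> y = 0" for y
    using zero inv[of y] by (cases "y = 0") auto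
  \<comment> \<open>For \<open>z = 0\<close> both sides are 0, by the convention for division by
    zero.\<close>
  have "\<sigma> (y / z) = \<sigma> y / \<sigma> z" for y z
  proof (cases "z = 0")
    case False
    thus ?thesis
      using inv[of z] eq_0 by (simp add: mult divide_inverse inverse_unique)
  qed (simp add: zero)
  thus ?thesis
    by (cases x) (simp_all add: eq_0 flip: add mult)
qed

theorem theorem1p2:
  fixes x :: rat
  shows "g_map qvar (right_qrat x) = map_proj (ratfun_subst (inverse qvar)) (left_qrat x)"
proof -
  let ?\<sigma> = "ratfun_subst (inverse qvar)"
  note hom = ratfun_subst_inverse_add ratfun_subst_inverse_mult ratfun_subst_inverse_1
  have det: "qvar * qvar - qvar + 1 \<noteq> 0"
  proof -
    have "qvar * qvar - qvar + 1 = to_fract [:1, - 1, 1:]"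
      unfolding qvar_def
      by (simp flip: to_fract_mult to_fract_diff to_fract_add to_fract_1 add: one_pCons)
    thus ?thesis
      by simp
  qed
  have neg: "?\<sigma> (- 1) = - 1"
    using ratfun_subst_inverse_add[of "- 1" 1] by (simp add: eq_neg_iff_add_eq_0)
  have \<sigma>: "map_proj ?\<sigma> (cf_word qvar as y) = cf_word (inverse qvar) as (map_proj ?\<sigma> y)" for as y
    by (intro cf_word_intertwine) (simp_all add: T_map_def S_map_def map_proj_moebius[OF hom] neg)
  have g: "g_map qvar (cf_word qvar as y) = cf_word (inverse qvar) as (g_map qvar y)" for as y
    using det by (intro cf_word_intertwine g_map_T_map g_map_S_map) simp_all
  have "qvar \<noteq> 1"
    unfolding qvar_def by (simp flip: to_fract_1 add: one_pCons)
  \<comment> \<open>As an image of \<open>Infty\<close>, the base point can be transported by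
    \<open>map_proj_moebius\<close>; the sum form of \<open>1 - qvar\<close> fits the rules for
    sums, products and \<open>- 1\<close>.\<close>
  hence "Fin (1 / (1 - qvar)) = moebius 1 0 (1 + - 1 * qvar) 1 Infty"
    by simp
  also have "map_proj ?\<sigma> \<dots> = moebius 1 0 (1 - inverse qvar) 1 Infty"
    unfolding map_proj_moebius[OF hom] hom neg by simp
  \<comment> \<open>Both points are \<open>q / (q - 1)\<close>.\<close>
  also have "\<dots> = g_map qvar Infty"
    using \<open>qvar \<noteq> 1\<close> by (simp add: g_map_def field_simps)
  finally have "map_proj ?\<sigma> (Fin (1 / (1 - qvar))) = g_map qvar Infty" .
  thus ?thesis
    by (simp add: right_qrat_def left_qrat_def \<sigma> g)
qed

end
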